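(* Let $\pi/2\le\alpha<\pi$ and let $f\in\mathcal{A}$ satisfy the subordination $$1+\frac{zf''(z)}{f'(z)}\prec 1+F_\alpha(z)\qquad(z\in\mathbb{U}).$$ Then $$\frac{zf'(z)}{f(z)}\prec 1+F_\alpha(z)\qquad(z\in\mathbb{U}),$$ that is, $f\in\mathcal{MS}(\alpha)$.
   Context: $\mathbb{U}=\{z\in\mathbb{C}:|z|<1\}$. $\mathcal{A}$ is the class of functions $f(z)=z+\sum_{n=2}^\infty a_nz^n$ that are analytic and univalent in $\mathbb{U}$. For $\pi/2\le\alpha<\pi$, $\mathcal{MS}(\alpha)$ is the class of all $f\in\mathcal{A}$ such that $$1+\frac{\alpha-\pi}{2\sin\alpha}<\Re\left(\frac{zf'(z)}{f(z)}\right)<1+\frac{\alpha}{2\sin\alpha}\qquad(z\in\mathbb{U}),$$ where $zf'(z)/f(z)$ is given the value $1$ at $z=0$. For $\pi/2\le\alpha<\pi$, $$F_\alpha(z)=\frac{1}{2i\sin\alpha}\log\left(\frac{1+e^{i\alpha}z}{1+e^{-i\alpha}z}\right)\qquad(z\in\mathbb{U}),$$ with the principal branch of the logarithm. For functions $g,h$ analytic in $\mathbb{U}$, $g\prec h$ ($g$ is subordinate to $h$) means that there is an analytic function $w$ on $\mathbb{U}$ with $w(0)=0$ and $|w(z)|<1$ on $\mathbb{U}$ such that $g(z)=h(w(z))$ for all $z\in\mathbb{U}$. *)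

theory Defs
  imports "HOL-Complex_Analysis.Complex_Analysis"
begin

abbreviation unit_disc :: "complex set" where
  "unit_disc \<equiv> ball 0 1"

definition class_A :: "(complex \<Rightarrow> complex) set" where
  "class_A = {f. f holomorphic_on unit_disc \<and> inj_on f unit_disc \<and>
     (\<exists>a :: nat \<Rightarrow> complex. \<forall>z\<in>unit_disc. ((\<lambda>n. a (n + 2) * z ^ (n + 2)) sums (f z - z)))}"

text \<open>The quotient \<open>z f'(z) / f(z)\<close> with its removable singularity at the origin filled in.\<close>

definition starlike_quot :: "(complex \<Rightarrow> complex) \<Rightarrow> complex \<Rightarrow> complex" where
  "starlike_quot f z = (if z = 0 then 1 else z * deriv f z / f z)"

definition class_MS :: "real \<Rightarrow> (complex \<Rightarrow> complex) set" where
  "class_MS \<alpha> = {f \<in> class_A. \<forall>z\<in>unit_disc.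
     1 + (\<alpha> - pi) / (2 * sin \<alpha>) < Re (starlike_quot f z) \<and>
     Re (starlike_quot f z) < 1 + \<alpha> / (2 * sin \<alpha>)}"

definition F_MS :: "real \<Rightarrow> complex \<Rightarrow> complex" where
  "F_MS \<alpha> z = 1 / (2 * \<i> * of_real (sin \<alpha>)) *
     Ln ((1 + exp (\<i> * of_real \<alpha>) * z) / (1 + exp (- (\<i> * of_real \<alpha>)) * z))"

text \<open>Subordination is a relation between functions analytic in the disc; both holomorphy
  requirements are part of it.\<close>

definition subordinate :: "(complex \<Rightarrow> complex) \<Rightarrow> (complex \<Rightarrow> complex) \<Rightarrow> bool" (infix "\<prec>" 50) where
  "g \<prec> h \<longleftrightarrow> g holomorphic_on unit_disc \<and> h holomorphic_on unit_disc \<and>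
     (\<exists>w. w holomorphic_on unit_disc \<and> w 0 = 0 \<and> (\<forall>z\<in>unit_disc. norm (w z) < 1) \<and>
          (\<forall>z\<in>unit_disc. g z = h (w z)))"

lemma class_A_iff:
  "f \<in> class_A \<longleftrightarrow> f holomorphic_on unit_disc \<and> inj_on f unit_disc \<and> f 0 = 0 \<and> deriv f 0 = 1"
proof (cases "f holomorphic_on unit_disc")
  case hol: True
  define c where "c n = (deriv ^^ n) f 0 / fact n" for n
  have c: "(\<lambda>n. c n * z ^ n) sums f z" if "z \<in> unit_disc" for z
    using holomorphic_power_series[OF hol that] by (simp add: c_def)
  have tail: "((\<lambda>n. c (n + 2) * z ^ (n + 2)) sums (f z - (f 0 + deriv f 0 * z)))"
    if "z \<in> unit_disc" for z
    using sums_split_initial_segment[OF c[OF that], of 2]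
    by (simp add: c_def numeral_2_eq_2)
  have "f 0 = 0 \<and> deriv f 0 = 1"
    if a: "\<forall>z\<in>unit_disc. (\<lambda>n. a (n + 2) * z ^ (n + 2)) sums (f z - z)" for a
  proof -
    define b where "b n = (if n = 0 then 0 else if n = 1 then 1 else a n)" for n :: nat
    have b: "(\<lambda>n. b n * z ^ n) sums f z" if "z \<in> unit_disc" for z
    proof -
      have "(\<lambda>n. b (n + 2) * z ^ (n + 2)) sums (f z - (\<Sum>i<2. b i * z ^ i))"
        using a that by (simp add: b_def numeral_2_eq_2)
      then show ?thesis by (subst (asm) sums_iff_shift) simp
    qed
    have f0: "f 0 = 0" using b[of 0] sums_unique2[OF b[of 0] powser_sums_zero[of b]] by (simp add: b_def)
    have "b 1 = (deriv ^^ 1) f 0 / fact 1"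
    proof -
      have "f has_fps_expansion Abs_fps b"
      proof (rule has_fps_expansionI)
        have "\<forall>\<^sub>F z in nhds (0::complex). z \<in> unit_disc"
          by (intro eventually_nhds_in_open) auto
        then show "\<forall>\<^sub>F u in nhds 0. (\<lambda>n. fps_nth (Abs_fps b) n * u ^ n) sums f u"
          by eventually_elim (use b in simp)
      qed
      from fps_nth_fps_expansion[OF this, of 1] show ?thesis by simp
    qed
    then show ?thesis using f0 by (simp add: b_def)
  qed
  moreover have "\<exists>a. \<forall>z\<in>unit_disc. (\<lambda>n. a (n + 2) * z ^ (n + 2)) sums (f z - z)"
    if "f 0 = 0" "deriv f 0 = 1"
    using tail that by (intro exI[of _ c]) simp
  ultimately show ?thesis using hol unfolding class_A_def by blast
qed (simp add: class_A_def)

end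

theory Submission
  imports Defs
begin

text \<open>
  With \<open>p = z f' / f\<close>, logarithmic differentiation gives \<open>1 + z f'' / f' = p + z p' / p\<close>.
  The image of \<open>1 + F\<^sub>\<alpha>\<close> is the vertical strip in the definition of \<open>class_MS\<close>, so the
  hypothesis confines \<open>p + z p' / p\<close> to that strip, and the task is to confine \<open>p\<close> itself.

  The strip is the intersection of two half-planes, which can be treated one at a time. If \<open>p\<close>
  leaves a half-plane that contains \<open>p 0 = 1\<close>, consider a point \<open>z\<close> of least modulus where it
  does. There \<open>p\<close> touches the edge \<open>Re = c\<close> from inside, so the vector \<open>z p'(z)\<close> is zero or an
  outward normal of the edge (\<open>half_plane_first_touching_point\<close>): it is real and does not point
  inward. Since \<open>Re (1 / p) = c / |p|\<^sup>2 \<ge> 0\<close>, adding \<open>z p' / p\<close> moves the value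
  further outward or leaves it on the edge, so \<open>p + z p' / p\<close> is outside the half-plane as well,
  a contradiction (\<open>half_plane_briot_bouquet\<close>). Both edges have \<open>c \<ge> 0\<close>; for the left one this
  is where \<open>\<alpha> \<ge> \<pi>/2\<close> enters, through \<open>t \<le> 2 sin t\<close> on \<open>[0, \<pi>/2]\<close>.

  Finally, a function that takes values in the strip and the value \<open>1\<close> at \<open>0\<close> is subordinate to
  \<open>1 + F\<^sub>\<alpha>\<close>, because \<open>F\<^sub>\<alpha>\<close> has an explicit inverse on the strip
  (\<open>subordinate_F_MS_if_in_strip\<close>). Both this and the description of the image of \<open>F\<^sub>\<alpha>\<close> rest on
  one identity for the modulus of a Moebius transformation
  (\<open>norm_moebius_exp_diff\<close>).
\<close>

section \<open>First exit from a half-plane\<close>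

text \<open>Compactness provides a point of least modulus where \<open>Re g \<ge> c\<close>. Moving from it in any
  direction \<open>z v\<close> with \<open>Re v < 0\<close> enters the disc of smaller moduli, where \<open>Re g < c\<close>, so the
  derivative of \<open>Re g\<close> in that direction is nonpositive; letting \<open>v\<close> range over this half-plane
  leaves only nonnegative reals for \<open>z g'(z)\<close>.\<close>

lemma half_plane_first_touching_point:
  fixes g :: "complex \<Rightarrow> complex" and c :: real
  assumes hol: "g holomorphic_on ball 0 R"
    and g0: "Re (g 0) < c" and z1: "z1 \<in> ball 0 R" "c \<le> Re (g z1)"
  obtains z where "z \<in> ball 0 R" "z \<noteq> 0" "Re (g z) = c"
    "Im (z * deriv g z) = 0" "0 \<le> Re (z * deriv g z)"
proof -
  define S where "S = {z \<in> cball 0 (norm z1). c \<le> Re (g z)}"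
  have sub: "cball 0 (norm z1) \<subseteq> ball 0 R"
    using z1 by auto
  have cont: "continuous_on (ball 0 R) (\<lambda>z. Re (g z))"
    by (intro continuous_intros holomorphic_on_imp_continuous_on hol)
  have "closed S"
    unfolding S_def
    by (intro continuous_on_closed_Collect_le continuous_on_subset[OF cont sub] continuous_intros)
       simp
  moreover have "S \<noteq> {}"
    using z1 by (auto simp: S_def)
  ultimately obtain z where zS: "z \<in> S" and zmin: "\<And>y. y \<in> S \<Longrightarrow> dist 0 z \<le> dist 0 y"
    using distance_attains_inf[of S 0] by metis
  have z_le: "norm z \<le> norm z1" and gz_ge: "c \<le> Re (g z)"
    using zS by (auto simp: S_def)
  have zR: "z \<in> ball 0 R"
    using z_le z1(1) by simp
  have z_nz: "z \<noteq> 0"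
    using gz_ge g0 by auto
  have below: "Re (g y) < c" if "norm y < norm z" for y
    using zmin[of y] that z_le by (force simp: S_def)
  have closure_eq: "closure (ball (0 :: complex) (norm z)) = cball 0 (norm z)"
    using z_nz by simp
  have "Re (g z) \<le> c"
  proof (rule continuous_le_on_closure[where S = "ball 0 (norm z)" and f = "\<lambda>z. Re (g z)"])
    show "continuous_on (closure (ball 0 (norm z))) (\<lambda>z. Re (g z))"
      unfolding closure_eq using z_le sub by (intro continuous_on_subset[OF cont]) auto
    show "z \<in> closure (ball 0 (norm z))"
      unfolding closure_eq by simp
    show "Re (g y) \<le> c" if "y \<in> ball 0 (norm z)" for y
      using below[of y] that by simp
  qed
  then have gz: "Re (g z) = c"
    using gz_ge by simp
  define D where "D = z * deriv g z"
  have direction: "Re (D * Complex (-1) N) \<le> 0" for N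
  proof (rule ccontr)
    define v where "v = Complex (-1) N"
    assume "\<not> Re (D * Complex (-1) N) \<le> 0"
    then have pos: "0 < Re (D * v)"
      by (simp add: v_def)
    define h where "h t = Re (g (z * (1 + of_real t * v)))" for t :: real
    have "(g has_field_derivative deriv g z) (at z)"
      by (rule holomorphic_derivI[OF hol _ zR]) simp
    then have "(g has_field_derivative deriv g z) (at (z * (1 + of_real 0 * v)))"
      by simp
    moreover have "((\<lambda>t. z * (1 + of_real t * v)) has_vector_derivative (z * v)) (at 0)"
      by (auto intro!: derivative_eq_intros simp: has_vector_derivative_def scaleR_conv_of_real)
    ultimately have "((g \<circ> (\<lambda>t. z * (1 + of_real t * v))) has_vector_derivative (z * v * deriv g z))
        (at 0)"
      by (intro field_vector_diff_chain_at)
    then have "((\<lambda>t. Re ((g \<circ> (\<lambda>t. z * (1 + of_real t * v))) t)) has_vector_derivative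
        Re (z * v * deriv g z)) (at 0)"
      by (rule bounded_linear.has_vector_derivative[OF bounded_linear_Re])
    then have "DERIV h 0 :> Re (D * v)"
      unfolding has_real_derivative_iff_has_vector_derivative h_def o_def D_def
      by (simp only: mult_ac)
    from DERIV_pos_inc_right[OF this pos] obtain d
      where d: "d > 0" "\<And>t. 0 < t \<Longrightarrow> t < d \<Longrightarrow> h 0 < h t"
      by auto
    (* |1 + t v|^2 = 1 - 2 t + t^2 (1 + N^2) is below 1 for 0 < t < 2 / (1 + N^2). *)
    define t where "t = min (d / 2) (1 / (1 + N\<^sup>2))"
    have N: "1 + N\<^sup>2 > 0"
      by (simp add: add_pos_nonneg)
    have t: "0 < t" "t < d" "t * (1 + N\<^sup>2) \<le> 1"
      using d(1) N by (auto simp: t_def min_def field_simps)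
    have "(norm (1 + of_real t * v))\<^sup>2 = 1 - 2 * t + t * (t * (1 + N\<^sup>2))"
      unfolding cmod_power2 by (simp add: v_def power2_eq_square algebra_simps)
    also have "\<dots> < 1"
      using t mult_left_mono[OF t(3), of t] by simp
    finally have "norm (1 + of_real t * v) < 1"
      by (simp add: power_less_one_iff abs_square_less_1)
    then have "h t < c"
      unfolding h_def using z_nz by (intro below) (simp add: norm_mult)
    moreover have "h 0 = c"
      by (simp add: h_def gz)
    ultimately show False
      using d(2)[OF t(1,2)] by simp
  qed
  have "Im D = 0"
  proof (rule ccontr)
    assume "Im D \<noteq> 0"
    (* this N makes the directional derivative - Re D - N Im D equal to 1 *)
    with direction[of "- (Re D + 1) / Im D"] show False
      by (simp add: field_simps)
  qed
  moreover have "0 \<le> Re D"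
    using direction[of 0] by simp
  ultimately show ?thesis
    using that[OF zR z_nz gz] by (simp add: D_def)
qed

text \<open>The sign of \<open>s\<close> selects the half-plane to the left or to the right of the line
  \<open>Re = c\<close>. At a first touching point, \<open>s z p'\<close> is a real \<open>k \<ge> 0\<close>, so that
  \<open>s Re (p + z p' / p) = s c + k c / |p|\<^sup>2 \<ge> s c\<close>.\<close>

lemma half_plane_briot_bouquet:
  fixes p :: "complex \<Rightarrow> complex" and c s :: real
  assumes hol: "p holomorphic_on ball 0 R" and c: "0 \<le> c"
    and p0: "s * Re (p 0) < s * c"
    and bb: "\<And>z. z \<in> ball 0 R \<Longrightarrow> z \<noteq> 0 \<Longrightarrow> s * Re (p z + z * deriv p z / p z) < s * c"
    and z1: "z1 \<in> ball 0 R"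
  shows "s * Re (p z1) < s * c"
proof (rule ccontr)
  assume contra: "\<not> s * Re (p z1) < s * c"
  define g where "g z = of_real s * p z" for z
  have "g holomorphic_on ball 0 R"
    unfolding g_def by (intro holomorphic_intros hol)
  then obtain z where z: "z \<in> ball 0 R" "z \<noteq> 0" "Re (g z) = s * c"
    and real: "Im (z * deriv g z) = 0" and nonneg: "0 \<le> Re (z * deriv g z)"
    using half_plane_first_touching_point[of g R "s * c" z1] p0 z1 contra
    by (auto simp: g_def)
  have s: "s \<noteq> 0"
    using p0 by auto
  have pz: "Re (p z) = c"
    using z(3) s by (simp add: g_def)
  have "p field_differentiable at z"
    using hol z(1) by (auto simp: holomorphic_on_open field_differentiable_def)
  then have dg: "deriv g z = of_real s * deriv p z"
    unfolding g_def by (rule deriv_cmult)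
  define k where "k = Re (z * deriv g z)"
  have k: "of_real s * (z * deriv p z) = of_real k"
    using real by (simp add: k_def dg complex_eq_iff mult_ac)
  have "s * Re x = Re (of_real s * x)" for x
    by simp
  then have "s * Re (z * deriv p z / p z) = Re (of_real s * (z * deriv p z / p z))" .
  also have "of_real s * (z * deriv p z / p z) = of_real s * (z * deriv p z) / p z"
    by simp
  also have "Re \<dots> = k * c / (norm (p z))\<^sup>2"
    unfolding k by (simp add: Re_divide pz cmod_power2)
  also have "\<dots> \<ge> 0"
    using nonneg c by (simp add: k_def)
  finally show False
    using bb[OF z(1,2)] pz by (simp add: algebra_simps)
qed

section \<open>The quotient \<open>z f'(z) / f(z)\<close> of a univalent function\<close>

text \<open>Dividing the zero at the origin out of \<open>f\<close> leaves a holomorphic \<open>h\<close> without zeros, and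
  the quotient is \<open>f' / h\<close>.\<close>

lemma starlike_quot_holomorphic:
  assumes "f \<in> class_A"
  shows "starlike_quot f holomorphic_on unit_disc"
proof -
  have hol: "f holomorphic_on unit_disc" and inj: "inj_on f unit_disc"
    and f0: "f 0 = 0" and df0: "deriv f 0 = 1"
    using assms by (auto simp: class_A_iff)
  define h where "h z = (if z = 0 then deriv f 0 else (f z - f 0) / (z - 0))" for z
  have "h holomorphic_on unit_disc"
    unfolding h_def by (rule pole_lemma_open[OF hol]) simp
  moreover have "h z \<noteq> 0" if "z \<in> unit_disc" for z
    using inj_onD[OF inj, of z 0] that by (auto simp: h_def f0 df0)
  ultimately have "(\<lambda>z. deriv f z / h z) holomorphic_on unit_disc"
    by (intro holomorphic_intros holomorphic_deriv hol) auto
  moreover have "deriv f z / h z = starlike_quot f z" for z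
    by (auto simp: h_def starlike_quot_def f0 df0)
  ultimately show ?thesis
    by simp
qed

text \<open>Differentiate \<open>z f' = p f\<close>, where \<open>p\<close> is the quotient, and divide by \<open>f'\<close>, which has no
  zeros because \<open>f\<close> is univalent.\<close>

lemma starlike_quot_log_deriv:
  assumes f: "f \<in> class_A" and z: "z \<in> unit_disc" "z \<noteq> 0"
  shows "starlike_quot f z + z * deriv (starlike_quot f) z / starlike_quot f z =
    1 + z * deriv (deriv f) z / deriv f z"
proof -
  define p where "p = starlike_quot f"
  have hol: "f holomorphic_on unit_disc" and inj: "inj_on f unit_disc"
    and f0: "f 0 = 0"
    using f by (auto simp: class_A_iff)
  have f_nz: "f u \<noteq> 0" if "u \<in> unit_disc" "u \<noteq> 0" for u
    using inj_onD[OF inj, of u 0] that f0 by auto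
  have df_nz: "deriv f z \<noteq> 0"
    using holomorphic_injective_imp_regular[OF hol _ inj z(1)] by simp
  have pf: "p u * f u = u * deriv f u" if "u \<in> unit_disc" for u
    using f_nz[OF that] by (auto simp: p_def starlike_quot_def f0)
  have Df: "(f has_field_derivative deriv f z) (at z)"
    by (rule holomorphic_derivI[OF hol _ z(1)]) simp
  have Ddf: "(deriv f has_field_derivative deriv (deriv f) z) (at z)"
    by (rule holomorphic_derivI[OF holomorphic_deriv[OF hol] _ z(1)]) simp_all
  have Dp: "(p has_field_derivative deriv p z) (at z)"
    unfolding p_def by (rule holomorphic_derivI[OF starlike_quot_holomorphic[OF f] _ z(1)]) simp
  have "((\<lambda>u. u * deriv f u) has_field_derivative (deriv p z * f z + deriv f z * p z)) (at z)"
    by (rule has_field_derivative_transform_within_open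
          [OF DERIV_mult[OF Dp Df] open_ball z(1) pf])
  moreover have "((\<lambda>u. u * deriv f u) has_field_derivative
      (1 * deriv f z + deriv (deriv f) z * z)) (at z)"
    by (rule DERIV_mult[OF DERIV_ident Ddf])
  ultimately have eq: "deriv p z * f z + deriv f z * p z = deriv f z + deriv (deriv f) z * z"
    by (metis DERIV_unique mult_1)
  have pz: "p z = z * deriv f z / f z"
    using z(2) by (simp add: p_def starlike_quot_def)
  have "z * deriv p z / p z = deriv p z * f z / deriv f z"
    using z(2) f_nz[OF z] df_nz by (simp add: pz field_simps)
  then have "p z + z * deriv p z / p z = (deriv p z * f z + deriv f z * p z) / deriv f z"
    using df_nz by (simp add: field_simps)
  also have "\<dots> = 1 + z * deriv (deriv f) z / deriv f z"
    unfolding eq using df_nz by (simp add: field_simps)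
  finally show ?thesis
    unfolding p_def .
qed

section \<open>The strip as the image of \<open>1 + F\<^sub>\<alpha>\<close>\<close>

text \<open>The inverse of \<open>z \<mapsto> (1 + e\<^sup>i\<^sup>\<alpha> z) / (1 + e\<^sup>-\<^sup>i\<^sup>\<alpha> z)\<close> sends \<open>e\<^sup>\<zeta>\<close> to
  \<open>(e\<^sup>\<zeta> - 1) / (e\<^sup>i\<^sup>\<alpha> - e\<^sup>-\<^sup>i\<^sup>\<alpha> e\<^sup>\<zeta>)\<close>. The identity shows that this has modulus below \<open>1\<close> exactly
  when \<open>sin \<alpha> sin (\<alpha> - Im \<zeta>) > 0\<close>.\<close>

lemma norm_moebius_exp_diff:
  fixes \<alpha> :: real and \<zeta> :: complex
  shows "(norm (exp (\<i> * \<alpha>) - exp (- (\<i> * \<alpha>)) * exp \<zeta>))\<^sup>2 - (norm (exp \<zeta> - 1))\<^sup>2 =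
    4 * exp (Re \<zeta>) * sin \<alpha> * sin (\<alpha> - Im \<zeta>)"
proof -
  define r x y u v where "r = exp (Re \<zeta>)" and "x = cos (Im \<zeta>)" and "y = sin (Im \<zeta>)"
    and "u = cos \<alpha>" and "v = sin \<alpha>"
  have xy: "x\<^sup>2 = 1 - y\<^sup>2" and uv: "u\<^sup>2 = 1 - v\<^sup>2"
    by (simp_all add: x_def y_def u_def v_def cos_squared_eq)
  have "(norm (exp (\<i> * \<alpha>) - exp (- (\<i> * \<alpha>)) * exp \<zeta>))\<^sup>2 - (norm (exp \<zeta> - 1))\<^sup>2 =
      ((u - (u * (r * x) + v * (r * y)))\<^sup>2 + (v - (u * (r * y) - v * (r * x)))\<^sup>2)
      - ((r * x - 1)\<^sup>2 + (r * y)\<^sup>2)"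
    unfolding cmod_power2
    by (simp add: Re_exp Im_exp r_def x_def y_def u_def v_def)
  also have "\<dots> = 4 * r * v * (v * x - u * y)"
    using xy uv by algebra
  also have "v * x - u * y = sin (\<alpha> - Im \<zeta>)"
    by (simp add: sin_diff u_def v_def x_def y_def)
  finally show ?thesis
    by (simp add: r_def v_def)
qed

lemma exp_ii_diff_nonzero:
  fixes \<alpha> :: real
  assumes "sin \<alpha> \<noteq> 0"
  shows "exp (\<i> * \<alpha>) \<noteq> exp (- (\<i> * \<alpha>))"
  using assms by (auto simp: complex_eq_iff Im_exp)

lemma Re_F_MS:
  "Re (F_MS \<alpha> z) =
    Im (Ln ((1 + exp (\<i> * of_real \<alpha>) * z) / (1 + exp (- (\<i> * of_real \<alpha>)) * z))) / (2 * sin \<alpha>)"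
proof -
  have "Re (1 / (2 * \<i> * of_real s) * L) = Im L / (2 * s)" for s :: real and L :: complex
  proof -
    have "1 / (2 * \<i> * of_real s) * L = (- \<i> * L) / of_real (2 * s)"
      by (cases "s = 0") (simp_all add: field_simps)
    then show ?thesis
      by (simp only: Re_divide_of_real) simp
  qed
  then show ?thesis
    unfolding F_MS_def .
qed

text \<open>The imaginary part of a principal logarithm lies in \<open>(-\<pi>, \<pi>]\<close>, and there positivity of
  \<open>sin (\<alpha> - Im \<zeta>)\<close> is the same as \<open>\<alpha> - \<pi> < Im \<zeta> < \<alpha>\<close>.\<close>

lemma F_MS_in_strip:
  assumes \<alpha>: "0 < \<alpha>" "\<alpha> < pi" and z: "norm z < 1"
  shows "(\<alpha> - pi) / (2 * sin \<alpha>) < Re (F_MS \<alpha> z)" and "Re (F_MS \<alpha> z) < \<alpha> / (2 * sin \<alpha>)"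
proof -
  have sin_pos: "sin \<alpha> > 0"
    using \<alpha> by (intro sin_gt_zero)
  have unimodular: "norm (exp (\<i> * complex_of_real \<alpha>)) = 1"
    "norm (exp (- (\<i> * complex_of_real \<alpha>))) = 1"
    by simp_all
  define E where "E = (1 + exp (\<i> * \<alpha>) * z) / (1 + exp (- (\<i> * \<alpha>)) * z)"
  have nz: "1 + w * z \<noteq> 0" if "norm w = 1" for w
  proof
    assume "1 + w * z = 0"
    then have "w * z = -1"
      by (simp add: add_eq_0_iff)
    then have "norm (w * z) = 1"
      by simp
    then show False
      using z that by (simp add: norm_mult)
  qed
  note nz' = nz[OF unimodular(1)] nz[OF unimodular(2)]
  have E_nz: "E \<noteq> 0"
    using nz' by (simp add: E_def)
  define \<zeta> where "\<zeta> = Ln E"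
  have exp_\<zeta>: "exp \<zeta> = E"
    using E_nz by (simp add: \<zeta>_def)
  have "E * (1 + exp (- (\<i> * \<alpha>)) * z) = 1 + exp (\<i> * \<alpha>) * z"
    using nz' by (simp add: E_def)
  then have moebius: "E - 1 = z * (exp (\<i> * \<alpha>) - exp (- (\<i> * \<alpha>)) * E)"
    by (simp add: algebra_simps)
  have den_nz: "exp (\<i> * \<alpha>) - exp (- (\<i> * \<alpha>)) * E \<noteq> 0"
    using moebius exp_ii_diff_nonzero[of \<alpha>] sin_pos by auto
  have "norm (E - 1) < norm (exp (\<i> * \<alpha>) - exp (- (\<i> * \<alpha>)) * E)"
    unfolding moebius norm_mult using z den_nz by simp
  then have "0 < 4 * exp (Re \<zeta>) * sin \<alpha> * sin (\<alpha> - Im \<zeta>)"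
    unfolding norm_moebius_exp_diff[symmetric] exp_\<zeta> by (simp add: power_strict_mono)
  moreover have "0 < 4 * exp (Re \<zeta>) * sin \<alpha>"
    using sin_pos by simp
  ultimately have sin_diff_pos: "0 < sin (\<alpha> - Im \<zeta>)"
    by (rule zero_less_mult_pos)
  have Im_\<zeta>: "- pi < Im \<zeta>" "Im \<zeta> \<le> pi"
    using E_nz by (simp_all add: \<zeta>_def mpi_less_Im_Ln Im_Ln_le_pi)
  have "Im \<zeta> < \<alpha>"
  proof (rule ccontr)
    assume "\<not> Im \<zeta> < \<alpha>"
    then have "0 \<le> sin (Im \<zeta> - \<alpha>)"
      using Im_\<zeta> \<alpha> by (intro sin_ge_zero) auto
    then show False
      using sin_diff_pos sin_minus[of "\<alpha> - Im \<zeta>"] by simp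
  qed
  moreover have "\<alpha> - pi < Im \<zeta>"
  proof (rule ccontr)
    assume "\<not> \<alpha> - pi < Im \<zeta>"
    then have "sin (\<alpha> - Im \<zeta>) \<le> 0"
      using Im_\<zeta> \<alpha> by (intro sin_le_zero) auto
    then show False
      using sin_diff_pos by simp
  qed
  ultimately show "(\<alpha> - pi) / (2 * sin \<alpha>) < Re (F_MS \<alpha> z)"
    and "Re (F_MS \<alpha> z) < \<alpha> / (2 * sin \<alpha>)"
    unfolding Re_F_MS E_def[symmetric] \<zeta>_def[symmetric]
    using sin_pos by (simp_all add: divide_strict_right_mono)
qed

text \<open>The subordinating function is the inverse of \<open>1 + F\<^sub>\<alpha>\<close> composed with \<open>q\<close>.\<close>

lemma subordinate_F_MS_if_in_strip:
  assumes \<alpha>: "0 < \<alpha>" "\<alpha> < pi"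
    and q: "q holomorphic_on unit_disc" "q 0 = 1"
    and F: "(\<lambda>z. 1 + F_MS \<alpha> z) holomorphic_on unit_disc"
    and lower: "\<And>z. z \<in> unit_disc \<Longrightarrow> 1 + (\<alpha> - pi) / (2 * sin \<alpha>) < Re (q z)"
    and upper: "\<And>z. z \<in> unit_disc \<Longrightarrow> Re (q z) < 1 + \<alpha> / (2 * sin \<alpha>)"
  shows "q \<prec> (\<lambda>z. 1 + F_MS \<alpha> z)"
proof -
  have sin_pos: "sin \<alpha> > 0"
    using \<alpha> by (intro sin_gt_zero)
  define a b where "a = exp (\<i> * complex_of_real \<alpha>)" and "b = exp (- (\<i> * complex_of_real \<alpha>))"
  have ab: "a \<noteq> b"
    unfolding a_def b_def using exp_ii_diff_nonzero sin_pos by auto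
  define \<zeta> where "\<zeta> z = 2 * \<i> * of_real (sin \<alpha>) * (q z - 1)" for z
  define w where "w z = (exp (\<zeta> z) - 1) / (a - b * exp (\<zeta> z))" for z
  have Im_\<zeta>: "\<alpha> - pi < Im (\<zeta> z)" "Im (\<zeta> z) < \<alpha>" if "z \<in> unit_disc" for z
    using lower[OF that] upper[OF that] sin_pos by (simp_all add: \<zeta>_def field_simps)
  have norm_less: "norm (exp (\<zeta> z) - 1) < norm (a - b * exp (\<zeta> z))" if "z \<in> unit_disc" for z
  proof -
    have "0 < sin (\<alpha> - Im (\<zeta> z))"
      using Im_\<zeta>[OF that] by (intro sin_gt_zero) auto
    then have "0 < 4 * exp (Re (\<zeta> z)) * sin \<alpha> * sin (\<alpha> - Im (\<zeta> z))"
      using sin_pos by simp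
    then show ?thesis
      unfolding norm_moebius_exp_diff[symmetric] a_def b_def
      by (simp add: power_less_imp_less_base)
  qed
  have den_nz: "a - b * exp (\<zeta> z) \<noteq> 0" if "z \<in> unit_disc" for z
    using norm_less[OF that] by fastforce
  have "w holomorphic_on unit_disc"
    unfolding w_def \<zeta>_def using den_nz
    by (intro holomorphic_intros q(1)) (auto simp: \<zeta>_def)
  moreover have "w 0 = 0"
    by (simp add: w_def \<zeta>_def q(2))
  moreover have "norm (w z) < 1" if "z \<in> unit_disc" for z
    using norm_less[OF that] den_nz[OF that] by (simp add: w_def norm_divide)
  moreover have "q z = 1 + F_MS \<alpha> (w z)" if "z \<in> unit_disc" for z
  proof -
    let ?E = "exp (\<zeta> z)"
    have num: "1 + a * w z = (a - b) * ?E / (a - b * ?E)"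
      and den: "1 + b * w z = (a - b) / (a - b * ?E)"
      using den_nz[OF that] by (simp_all add: w_def field_simps)
    have "(1 + a * w z) / (1 + b * w z) = ?E"
      unfolding num den using den_nz[OF that] ab by simp
    moreover have "Ln ?E = \<zeta> z"
      using Im_\<zeta>[OF that] \<alpha> by (intro Ln_exp) auto
    ultimately have "F_MS \<alpha> (w z) = 1 / (2 * \<i> * of_real (sin \<alpha>)) * \<zeta> z"
      by (simp add: F_MS_def a_def b_def)
    then show ?thesis
      using sin_pos by (simp add: \<zeta>_def)
  qed
  ultimately show ?thesis
    unfolding subordinate_def using q(1) F by blast
qed

section \<open>Convexity in the strip implies starlikeness in the strip\<close>

text \<open>This keeps the left edge of the strip in \<open>Re \<ge> 0\<close>. Halve the angle:
  \<open>sin t = 2 sin (t/2) cos (t/2) \<ge> t cos\<^sup>2 (t/2) = t (1 + cos t) / 2\<close>, by \<open>tan (t/2) \<ge> t/2\<close>.\<close>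

lemma le_twice_sin:
  fixes t :: real
  assumes t: "0 \<le> t" "t \<le> pi / 2"
  shows "t \<le> 2 * sin t"
proof -
  define u where "u = t / 2"
  have u: "0 \<le> u" "u < pi / 2"
    unfolding u_def using t pi_gt_zero by linarith+
  have cos_pos: "cos u > 0"
    using u by (intro cos_gt_zero_pi) auto
  have "u \<le> tan u"
    using abs_tan_ge[of u] u tan_pos_pi2_le[of u] by simp
  then have "u * cos u \<le> sin u"
    using cos_pos by (simp add: tan_def field_simps)
  then have "2 * (u * cos u * cos u) \<le> 2 * (sin u * cos u)"
    using cos_pos by simp
  also have "\<dots> = sin t"
    using sin_double[of u] by (simp add: u_def)
  also have "2 * (u * cos u * cos u) = t * (1 + cos t) / 2"
    using cos_double_cos[of u] by (simp add: u_def power2_eq_square algebra_simps)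
  finally have "t * (1 + cos t) \<le> 2 * sin t"
    by simp
  moreover have "0 \<le> t * cos t"
    using t by (intro mult_nonneg_nonneg cos_ge_zero) auto
  ultimately show ?thesis
    by (simp add: algebra_simps)
qed

theorem theorem3:
  fixes \<alpha> :: real and f :: "complex \<Rightarrow> complex"
  assumes "pi / 2 \<le> \<alpha>" and "\<alpha> < pi"
    and "f \<in> class_A"
    and "(\<lambda>z. 1 + z * deriv (deriv f) z / deriv f z) \<prec> (\<lambda>z. 1 + F_MS \<alpha> z)"
  shows "starlike_quot f \<prec> (\<lambda>z. 1 + F_MS \<alpha> z) \<and> f \<in> class_MS \<alpha>"
proof -
  have \<alpha>: "0 < \<alpha>" "\<alpha> < pi"
    using assms(1,2) pi_gt_zero by linarith+
  have sin_pos: "sin \<alpha> > 0"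
    using \<alpha> by (intro sin_gt_zero)
  define l u where "l = 1 + (\<alpha> - pi) / (2 * sin \<alpha>)" and "u = 1 + \<alpha> / (2 * sin \<alpha>)"
  have "pi - \<alpha> \<le> 2 * sin \<alpha>"
    using le_twice_sin[of "pi - \<alpha>"] assms(1,2) by simp
  then have l: "0 \<le> l" "l < 1" and u: "0 \<le> u" "1 < u"
    using sin_pos \<alpha> by (simp_all add: l_def u_def field_simps)
  define p where "p = starlike_quot f"
  have p: "p holomorphic_on unit_disc" "p 0 = 1"
    unfolding p_def using starlike_quot_holomorphic[OF assms(3)]
    by (simp_all add: starlike_quot_def)
  have bb: "l < Re (p z + z * deriv p z / p z)" "Re (p z + z * deriv p z / p z) < u"
    if z: "z \<in> unit_disc" "z \<noteq> 0" for z
  proof -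
    obtain w where "norm w < 1" "1 + z * deriv (deriv f) z / deriv f z = 1 + F_MS \<alpha> w"
      using assms(4) z(1) unfolding subordinate_def by blast
    then show "l < Re (p z + z * deriv p z / p z)" "Re (p z + z * deriv p z / p z) < u"
      unfolding p_def starlike_quot_log_deriv[OF assms(3) z]
      using F_MS_in_strip[OF \<alpha>, of w] by (simp_all add: l_def u_def)
  qed
  have upper: "Re (p z) < u" if "z \<in> unit_disc" for z
  proof -
    have "1 * Re (p z) < 1 * u"
      by (rule half_plane_briot_bouquet[OF p(1) u(1) _ _ that]) (use p(2) u(2) bb(2) in auto)
    then show ?thesis
      by simp
  qed
  have lower: "l < Re (p z)" if "z \<in> unit_disc" for z
  proof -
    have "- 1 * Re (p z) < - 1 * l"
      by (rule half_plane_briot_bouquet[OF p(1) l(1) _ _ that]) (use p(2) l(2) bb(1) in fastforce)+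
    then show ?thesis
      by simp
  qed
  have "p \<prec> (\<lambda>z. 1 + F_MS \<alpha> z)"
    using assms(4) lower upper
    by (intro subordinate_F_MS_if_in_strip \<alpha> p) (auto simp: subordinate_def l_def u_def)
  moreover have "f \<in> class_MS \<alpha>"
    using assms(3) lower upper by (simp add: class_MS_def p_def l_def u_def)
  ultimately show ?thesis
    by (simp add: p_def)
qed

end
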